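(* Let $a$ be a fourth-power-free integer and let $E_a/\mathbb{Q}$ be the elliptic curve $y^2=x^3+ax$. Let $P\in E_a(\mathbb{Q})$ be a nontorsion point. Then $$\widehat{h}(P) > \frac{1}{16}\log|a| + C(a),$$ where $$C(a)=\begin{cases} \frac12\log 2 & \text{if } a>0 \text{ and } a\equiv 1,5,7,9,13,15 \bmod 16,\\ \frac14\log 2 & \text{if } a>0 \text{ and either } a\equiv 20,36 \bmod 64 \text{ or } a\equiv 2,3,6,8,10,11,12,14 \bmod 16,\\ -\frac18\log 2 & \text{if } a>0 \text{ and } a\equiv 4,52 \bmod 64,\\ \frac{9}{16}\log 2 & \text{if } a<0 \text{ and } a\equiv 1,5,7,9,13,15 \bmod 16,\\ \frac{5}{16}\log 2 & \text{if } a<0 \text{ and either } a\equiv 20,36 \bmod 64 \text{ or } a\equiv 2,3,6,8,10,11,12,14 \bmod 16,\\ -\frac{1}{16}\log 2 & \text{if } a<0 \text{ and } a\equiv 4,52 \bmod 64. \end{cases}$$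
   Context: A fourth-power-free integer is a nonzero integer not divisible by $p^4$ for any prime $p$. For a rational number $s/t$ in lowest terms, $h(s/t)=\log\max\{|s|,|t|\}$. For a point $P\in E_a(\mathbb{Q})$, $P\neq O$, put $h(P)=h(x(P))$, and $h(O)=0$. The canonical height is normalised as $\widehat{h}(P)=\frac12\lim_{n\to\infty} 4^{-n}h(2^nP)$. *)

theory Defs
  imports Complex_Main "HOL-Algebra.Group" "HOL-Computational_Algebra.Primes"
begin

definition fourth_power_free :: "int \<Rightarrow> bool" where
  "fourth_power_free a \<longleftrightarrow> a \<noteq> 0 \<and> (\<forall>p::int. prime p \<longrightarrow> \<not> p ^ 4 dvd a)"

datatype ec_point = Infinity | Affine rat rat

fun on_curve :: "int \<Rightarrow> ec_point \<Rightarrow> bool" where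
  "on_curve a Infinity \<longleftrightarrow> True"
| "on_curve a (Affine x y) \<longleftrightarrow> y ^ 2 = x ^ 3 + of_int a * x"

(* Chord-tangent law. On the curve, x1 = x2 forces y1 = y2 or y1 = - y2, so the tangent
   slope is only used for doubling a point with nonzero y-coordinate. *)
fun ec_add :: "int \<Rightarrow> ec_point \<Rightarrow> ec_point \<Rightarrow> ec_point" where
  "ec_add a Infinity Q = Q"
| "ec_add a (Affine x1 y1) Infinity = Affine x1 y1"
| "ec_add a (Affine x1 y1) (Affine x2 y2) =
    (if x1 = x2 \<and> y1 = - y2 then Infinity
     else
       let m = (if x1 = x2 then (3 * x1 ^ 2 + of_int a) / (2 * y1)
                else (y2 - y1) / (x2 - x1));
           x3 = m ^ 2 - x1 - x2
       in Affine x3 (m * (x1 - x3) - y1))"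

(* The group E_a(Q). HOL-Algebra writes groups multiplicatively, so the multiple n P
   appears as the power of P with exponent n. *)
definition EC :: "int \<Rightarrow> ec_point monoid" where
  "EC a = \<lparr>carrier = {P. on_curve a P}, monoid.mult = ec_add a, one = Infinity\<rparr>"

definition nontorsion :: "int \<Rightarrow> ec_point \<Rightarrow> bool" where
  "nontorsion a P \<longleftrightarrow> (\<forall>n::nat. n > 0 \<longrightarrow> P [^]\<^bsub>EC a\<^esub> n \<noteq> \<one>\<^bsub>EC a\<^esub>)"

definition rat_height :: "rat \<Rightarrow> real" where
  "rat_height r = (case quotient_of r of (s, t) \<Rightarrow> ln (real_of_int (max \<bar>s\<bar> \<bar>t\<bar>)))"

fun naive_height :: "ec_point \<Rightarrow> real" where
  "naive_height Infinity = 0"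
| "naive_height (Affine x y) = rat_height x"

definition canonical_height :: "int \<Rightarrow> ec_point \<Rightarrow> real" where
  "canonical_height a P =
     1/2 * lim (\<lambda>n::nat. naive_height (P [^]\<^bsub>EC a\<^esub> ((2::nat) ^ n)) / 4 ^ n)"

(* The residue of a negative a is the nonnegative one. The undefined branches are
   reached only if a = 0 or 16 divides a, so never for a fourth-power-free a. *)
definition C :: "int \<Rightarrow> real" where
  "C a =
    (if a > 0 then
       if a mod 16 \<in> {1, 5, 7, 9, 13, 15} then 1/2 * ln 2
       else if a mod 64 \<in> {20, 36} \<or> a mod 16 \<in> {2, 3, 6, 8, 10, 11, 12, 14} then 1/4 * ln 2
       else if a mod 64 \<in> {4, 52} then - (1/8) * ln 2
       else undefined
     else if a < 0 then
       if a mod 16 \<in> {1, 5, 7, 9, 13, 15} then 9/16 * ln 2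
       else if a mod 64 \<in> {20, 36} \<or> a mod 16 \<in> {2, 3, 6, 8, 10, 11, 12, 14} then 5/16 * ln 2
       else if a mod 64 \<in> {4, 52} then - (1/16) * ln 2
       else undefined
     else undefined)"

end

theory Submission
  imports Defs
begin

text \<open>
  Write \<open>x(Q) = s/t\<close> in lowest terms. Duplication sends \<open>(s, t)\<close> to
  \<open>((s^2 - a t^2)^2, 4 s t (s^2 + a t^2))\<close>. If \<open>t\<close> is even and \<open>s\<close> is coprime to \<open>a\<close>, nothing
  cancels and the image pair has the same property; moreover the norm \<open>N = s^2 + |a| t^2\<close> at least
  becomes \<open>N^4\<close> (and at most \<open>5 N^4\<close>). As \<open>N\<close> is comparable with \<open>max(|s|, |t|)^2\<close>, the
  limit of \<open>4^-n h(2^n Q)\<close> exists and is at least \<open>1/2 log N\<close>.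

  This applies to \<open>Q = 2P\<close>, whose \<open>x\<close>-coordinate is a square \<open>\<alpha>^2/\<beta>^2\<close>: an odd prime dividing \<open>a\<close>
  cannot divide \<open>\<alpha>\<close>, since \<open>a\<close> is free of fourth powers. Here \<open>N = \<alpha>^4 + |a| \<beta>^4\<close>, which exceeds
  \<open>|a| \<beta>^4\<close>, and even \<open>2 |a| \<beta>^4\<close> if \<open>a < 0\<close> because then \<open>x(Q)^2 > -a\<close>. The constant comes from the
  power of 2 dividing \<open>\<beta>\<close>, which is even unless \<open>a\<close> is 4 or 52 mod 64. In that exceptional case \<open>\<alpha>\<close>
  is even, and one further duplication, in which exactly 16 cancels, leads to a pair as above.
\<close>

section \<open>The chord-tangent law and one case of associativity\<close>

text \<open>Two polynomial equations replace the quotient defining the slope, so that chord and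
  tangent are treated alike: the first determines \<open>m\<close> if \<open>x1 \<noteq> x2\<close>,
  the second if the points coincide.\<close>

lemma ec_add_AffineI:
  assumes "\<not> (x1 = x2 \<and> y1 = - y2)"
    and "m * (x2 - x1) = y2 - y1"
    and "m * (y1 + y2) = x1^2 + x1 * x2 + x2^2 + of_int a"
    and "x3 = m^2 - x1 - x2" and "y3 = m * (x1 - x3) - y1"
  shows "ec_add a (Affine x1 y1) (Affine x2 y2) = Affine x3 y3"
proof (cases "x1 = x2")
  case True
  then have "y1 = y2" using assms(2) by simp
  moreover have "y1 \<noteq> 0" using assms(1) True calculation by auto
  ultimately have "m = (3 * x1^2 + of_int a) / (2 * y1)"
    using assms(3) True by (simp add: field_simps power2_eq_square)
  then show ?thesis using assms True by (simp add: Let_def)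
next
  case False
  then have "m = (y2 - y1) / (x2 - x1)" using assms(2) by (simp add: field_simps)
  then show ?thesis using assms False by (simp add: Let_def)
qed

lemma ec_add_AffineE:
  assumes "on_curve a (Affine x1 y1)" "on_curve a (Affine x2 y2)"
    and "ec_add a (Affine x1 y1) (Affine x2 y2) \<noteq> Infinity"
  obtains m where "\<not> (x1 = x2 \<and> y1 = - y2)"
    and "m * (x2 - x1) = y2 - y1"
    and "m * (y1 + y2) = x1^2 + x1 * x2 + x2^2 + of_int a"
proof -
  have nd: "\<not> (x1 = x2 \<and> y1 = - y2)" using assms(3) by auto
  have c: "y1^2 = x1^3 + of_int a * x1" "y2^2 = x2^3 + of_int a * x2" using assms by auto
  show ?thesis
  proof (cases "x1 = x2")
    case True
    then have "y1^2 = y2^2" using c by simp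
    then have y: "y1 = y2" using nd True by (auto simp: power2_eq_iff)
    then have "y1 \<noteq> 0" using nd True by auto
    then show ?thesis
      using that[of "(3 * x1^2 + of_int a) / (2 * y1)"] nd True y
      by (simp add: field_simps power2_eq_square)
  next
    case False
    define m where "m = (y2 - y1) / (x2 - x1)"
    have m: "m * (x2 - x1) = y2 - y1" using False by (simp add: m_def)
    \<comment> \<open>The difference of the two curve equations contains the factor
      \<open>x2 - x1\<close>; cancelling it leaves the second slope equation.\<close>
    have "(x2 - x1) * (m * (y1 + y2) - (x1^2 + x1 * x2 + x2^2 + of_int a)) = 0"
      using m c by algebra
    then show ?thesis using that[of m] nd m False by simp
  qed
qed

lemma ec_add_closed:
  assumes "on_curve a P" "on_curve a Q"
  shows "on_curve a (ec_add a P Q)"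
proof (cases "P = Infinity \<or> Q = Infinity \<or> ec_add a P Q = Infinity")
  case True
  then show ?thesis using assms by (cases P; cases Q) auto
next
  case False
  then obtain x1 y1 x2 y2 where PQ: "P = Affine x1 y1" "Q = Affine x2 y2"
    by (meson ec_point.exhaust)
  then obtain m where nd: "\<not> (x1 = x2 \<and> y1 = - y2)"
    and m: "m * (x2 - x1) = y2 - y1"
      "m * (y1 + y2) = x1^2 + x1 * x2 + x2^2 + of_int a"
    using ec_add_AffineE[of a x1 y1 x2 y2] assms False by metis
  define x3 where "x3 = m^2 - x1 - x2"
  define y3 where "y3 = m * (x1 - x3) - y1"
  have "y1^2 = x1^3 + of_int a * x1" using assms PQ by simp
  then have "y3^2 = x3^3 + of_int a * x3" using m x3_def y3_def by algebra
  then show ?thesis using ec_add_AffineI[OF nd m x3_def y3_def] PQ by simp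
qed

text \<open>At abscissa \<open>x\<close> the line through the two points has height
  \<open>y\<close>. The sum is the reflected third intersection, so if its abscissa were
  \<open>x\<close>, its ordinate would be \<open>- y\<close>.\<close>

lemma ec_add_ne_right:
  assumes "on_curve a (Affine x1 y1)" "on_curve a (Affine x y)" "y \<noteq> 0"
  shows "ec_add a (Affine x1 y1) (Affine x y) \<noteq> Affine x y"
proof
  assume eq: "ec_add a (Affine x1 y1) (Affine x y) = Affine x y"
  then obtain m where nd: "\<not> (x1 = x \<and> y1 = - y)"
    and m: "m * (x - x1) = y - y1"
      "m * (y1 + y) = x1^2 + x1 * x + x^2 + of_int a"
    using ec_add_AffineE[OF assms(1,2)] by (metis ec_point.distinct(1))
  have "Affine (m^2 - x1 - x) (m * (x1 - (m^2 - x1 - x)) - y1) = Affine x y"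
    using ec_add_AffineI[OF nd m refl refl] eq by metis
  then have "m * (x1 - x) - y1 = y" by (metis ec_point.inject)
  then have "2 * y = 0" using m(1) by (simp add: right_diff_distrib)
  then show False using assms(3) by simp
qed

text \<open>Put \<open>S = R + P\<close>. If \<open>l\<close> and \<open>k\<close> are the slopes of the lines through \<open>S, P\<close> and \<open>S, - P\<close>
  and \<open>t\<close> is the slope of the tangent at \<open>P\<close>, then \<open>S - P\<close>, \<open>2P\<close> and \<open>- (S + P)\<close> lie on a line
  of slope \<open>l - k - t\<close>.\<close>
lemma ec_add_add_same:
  assumes a: "a \<noteq> 0" and R: "on_curve a (Affine x1 y1)" and P: "on_curve a (Affine x y)"
    and "y \<noteq> 0"
    and "ec_add a (Affine x1 y1) (Affine x y) \<noteq> Infinity"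
    and "ec_add a (ec_add a (Affine x1 y1) (Affine x y)) (Affine x y) \<noteq> Infinity"
  shows "ec_add a (ec_add a (Affine x1 y1) (Affine x y)) (Affine x y) =
    ec_add a (Affine x1 y1) (ec_add a (Affine x y) (Affine x y))"
proof -
  obtain n where nd: "\<not> (x1 = x \<and> y1 = - y)"
    and n: "n * (x - x1) = y - y1"
      "n * (y1 + y) = x1^2 + x1 * x + x^2 + of_int a"
    using ec_add_AffineE[OF R P] assms(5) by metis
  define u where "u = n^2 - x1 - x"
  define v where "v = n * (x1 - u) - y1"
  have S: "ec_add a (Affine x1 y1) (Affine x y) = Affine u v"
    by (rule ec_add_AffineI[OF nd n u_def v_def])
  have Sc: "on_curve a (Affine u v)" using ec_add_closed[OF R P] S by simp
  \<comment> \<open>\<open>S\<close> could share its abscissa with \<open>P\<close> only if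
    \<open>S = P\<close>, which \<open>ec_add_ne_right\<close> excludes, or \<open>S = - P\<close>,
    which would make \<open>S + P\<close> infinite.\<close>
  have "u \<noteq> x"
  proof
    assume "u = x"
    then have "v^2 = y^2" using Sc P by simp
    then have "v = y \<or> v = - y" by (simp add: power2_eq_iff)
    then show False using assms(6) S \<open>u = x\<close> ec_add_ne_right[OF R P \<open>y \<noteq> 0\<close>] by auto
  qed
  define l where "l = (y - v) / (x - u)"
  have l: "l * (x - u) = y - v" using \<open>u \<noteq> x\<close> by (simp add: l_def)
  \<comment> \<open>Reflecting the line through \<open>R\<close>, \<open>P\<close> and
    \<open>- S\<close> shows that the slope \<open>k\<close> of the line through \<open>S\<close>
    and \<open>- P\<close> is \<open>- n\<close>.\<close>
  have k: "- n * (u - x) = v + y" using n v_def by algebra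
  have yn: "y = (l + n) * (x - u) / 2" using l k by (simp add: algebra_simps)
  have c: "y^2 = x^3 + of_int a * x" "v^2 = u^3 + of_int a * u" using P Sc by auto
  have "(u - x) * (l * (v + y) - (u^2 + u * x + x^2 + of_int a)) = 0"
    using l c by algebra
  then have l2: "l * (v + y) = u^2 + u * x + x^2 + of_int a" using \<open>u \<noteq> x\<close> by simp
  define x3 where "x3 = l^2 - u - x"
  define y3 where "y3 = l * (u - x3) - v"
  have SP: "ec_add a (Affine u v) (Affine x y) = Affine x3 y3"
    by (rule ec_add_AffineI[OF _ l l2 x3_def y3_def]) (use \<open>u \<noteq> x\<close> in simp)
  define t where "t = (3 * x^2 + of_int a) / (2 * y)"
  have t: "2 * y * t = 3 * x^2 + of_int a" using \<open>y \<noteq> 0\<close> by (simp add: t_def)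
  define x2 where "x2 = t^2 - x - x"
  define y2 where "y2 = t * (x - x2) - y"
  have PP: "ec_add a (Affine x y) (Affine x y) = Affine x2 y2"
    by (rule ec_add_AffineI[OF _ _ _ x2_def y2_def])
      (use \<open>y \<noteq> 0\<close> t in \<open>auto simp: power2_eq_square algebra_simps\<close>)
  have c2: "y2^2 = x2^3 + of_int a * x2" using ec_add_closed[OF P P] PP by simp
  define m where "m = l + n - t"
  \<comment> \<open>Eliminating \<open>of_int a\<close> between the tangent at \<open>P\<close> and
    the chord through \<open>S\<close> and \<open>P\<close> leaves a multiple of
    \<open>x - u\<close>. The relation obtained by cancelling it drives all later
    identities.\<close>
  have "(x - u) * (t * (l + n) - (2 * x + u + l * n)) = 0"
    using t yn l2 k l n \<open>u \<noteq> x\<close> by algebra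
  then have tl: "t * (l + n) = 2 * x + u + l * n" using \<open>u \<noteq> x\<close> by simp
  have x1: "x1 = n^2 - u - x" using u_def by simp
  have y1: "y1 = y - n * (x - x1)" using n by simp
  have m1: "m * (x2 - x1) = y2 - y1"
    using tl yn x1 y1 unfolding m_def x2_def y2_def by algebra
  have x3: "x3 = m^2 - x1 - x2"
    using tl x1 unfolding m_def x2_def x3_def by algebra
  have y3: "y3 = m * (x1 - x3) - y1"
    using tl yn x1 y1 l unfolding m_def x2_def x3_def y3_def by algebra
  have av: "of_int a = l * n * (x - u) - (u^2 + u * x + x^2)" using l2 k by algebra
  have m2: "m * (y1 + y2) = x1^2 + x1 * x2 + x2^2 + of_int a"
    using tl t c(1) yn av x1 y1 unfolding m_def x2_def y2_def by algebra
  \<comment> \<open>Otherwise \<open>x2\<close> would be a double root of the cubic, and the curve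
    would be singular, which \<open>a \<noteq> 0\<close> forbids.\<close>
  have "\<not> (x1 = x2 \<and> y1 = - y2)"
  proof
    assume d: "x1 = x2 \<and> y1 = - y2"
    then have "y2 = 0" using m1 by simp
    then have e: "3 * x2^2 + of_int a = 0" "x2 * (x2^2 + of_int a) = 0"
      using m2 c2 d by algebra+
    then have "x2 = 0 \<or> x2^2 = 0" by algebra
    then show False using e a by simp
  qed
  then show ?thesis
    using ec_add_AffineI[OF _ m1 m2 x3 y3] S SP PP by metis
qed

section \<open>Multiples and repeated doubling of a nontorsion point\<close>

lemma one_EC [simp]: "\<one>\<^bsub>EC a\<^esub> = Infinity"
  by (simp add: EC_def)

lemma mult_EC [simp]: "P \<otimes>\<^bsub>EC a\<^esub> Q = ec_add a P Q"
  by (simp add: EC_def)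

lemma EC_pow_closed: "on_curve a P \<Longrightarrow> on_curve a (P [^]\<^bsub>EC a\<^esub> (n::nat))"
  by (induction n) (simp_all add: ec_add_closed)

lemma nontorsionD: "nontorsion a P \<Longrightarrow> n > 0 \<Longrightarrow> P [^]\<^bsub>EC a\<^esub> (n::nat) \<noteq> Infinity"
  unfolding nontorsion_def by simp

lemma nontorsion_Affine:
  assumes "nontorsion a P"
  obtains x y where "P = Affine x y" "y \<noteq> 0"
proof -
  have "P \<noteq> Infinity" using nontorsionD[OF assms, of 1] by simp
  moreover have "ec_add a P P \<noteq> Infinity"
    using nontorsionD[OF assms, of 2] by (simp add: numeral_2_eq_2)
  ultimately show ?thesis using that by (cases P) (auto split: if_splits)
qed

text \<open>The induction needs associativity only in the form \<open>(R + P) + P = R + 2P\<close>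
  with \<open>R\<close> a multiple of \<open>P\<close>; nontorsion keeps the intermediate sums
  affine, as \<open>ec_add_add_same\<close> requires.\<close>

lemma EC_pow_double:
  assumes a: "a \<noteq> 0" and P: "on_curve a P" and nt: "nontorsion a P"
  shows "P [^]\<^bsub>EC a\<^esub> (2 * k :: nat) = ec_add a P P [^]\<^bsub>EC a\<^esub> k"
proof (induction k)
  case 0
  then show ?case by simp
next
  case (Suc k)
  obtain x y where xy: "P = Affine x y" "y \<noteq> 0" using nontorsion_Affine[OF nt] .
  define R where "R = P [^]\<^bsub>EC a\<^esub> (2 * k)"
  have R: "on_curve a R" unfolding R_def by (rule EC_pow_closed[OF P])
  have e: "P [^]\<^bsub>EC a\<^esub> (2 * Suc k) = ec_add a (ec_add a R P) P"
    by (simp add: R_def)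
  have "ec_add a R P \<noteq> Infinity" "ec_add a (ec_add a R P) P \<noteq> Infinity"
    using nontorsionD[OF nt, of "Suc (2 * k)"] nontorsionD[OF nt, of "2 * Suc k"] e
    by (simp_all add: R_def)
  then have "ec_add a (ec_add a R P) P = ec_add a R (ec_add a P P)"
    using ec_add_add_same[OF a] R P xy by (cases R) auto
  then show ?case using e Suc.IH by (simp add: R_def)
qed

lemma nontorsion_double:
  assumes "a \<noteq> 0" "on_curve a P" "nontorsion a P"
  shows "nontorsion a (ec_add a P P)"
  using EC_pow_double[OF assms, symmetric] nontorsionD[OF assms(3)]
  by (simp add: nontorsion_def)

lemma EC_pow_two_power:
  assumes "a \<noteq> 0" "on_curve a P" "nontorsion a P"
  shows "P [^]\<^bsub>EC a\<^esub> ((2::nat) ^ n) = ((\<lambda>Q. ec_add a Q Q) ^^ n) P"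
  using assms(2,3)
proof (induction n arbitrary: P)
  case 0
  then show ?case by simp
next
  case (Suc n)
  then show ?case
    using EC_pow_double[OF assms(1) Suc.prems] nontorsion_double[OF assms(1) Suc.prems]
      ec_add_closed by (simp add: funpow_Suc_right del: funpow.simps)
qed

section \<open>The duplication formula on fractions\<close>

text \<open>On the curve, \<open>(3 * x^2 + a)^2 - 8 * x * y^2\<close> collapses to
  \<open>(x^2 - a)^2\<close>, so the abscissa of a double is a rational square.\<close>

lemma ec_add_self_Affine:
  assumes "on_curve a (Affine x y)" "y \<noteq> 0"
  obtains y' where "ec_add a (Affine x y) (Affine x y) = Affine (((x^2 - of_int a) / (2 * y))^2) y'"
proof -
  define m where "m = (3 * x^2 + of_int a) / (2 * y)"
  have m: "2 * y * m = 3 * x^2 + of_int a" using assms(2) by (simp add: m_def)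
  have "(2 * y)^2 * (m^2 - x - x) = (x^2 - of_int a)^2"
    using m assms(1) by simp algebra
  then have "((x^2 - of_int a) / (2 * y))^2 = m^2 - x - x"
    using assms(2) by (simp add: field_simps)
  then have "ec_add a (Affine x y) (Affine x y) =
      Affine (((x^2 - of_int a) / (2 * y))^2) (m * (x - ((x^2 - of_int a) / (2 * y))^2) - y)"
    by (intro ec_add_AffineI) (use assms m in \<open>auto simp: power2_eq_square algebra_simps\<close>)
  then show ?thesis by (rule that)
qed

text \<open>The fraction is not assumed reduced. Cancellation is controlled separately, by
  \<open>coprime_duplication\<close> or by splitting off an explicit factor 16.\<close>

lemma ec_add_self_fraction:
  assumes c: "on_curve a (Affine (of_int s / of_int t) y)" and "y \<noteq> 0" "t \<noteq> 0"
  obtains y' where "4 * s * t * (s^2 + a * t^2) \<noteq> 0"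
    and "ec_add a (Affine (of_int s / of_int t) y) (Affine (of_int s / of_int t) y) =
      Affine (of_int ((s^2 - a * t^2)^2) / of_int (4 * s * t * (s^2 + a * t^2))) y'"
proof -
  define S T A :: rat where "S = of_int s" and "T = of_int t" and "A = of_int a"
  have T: "T \<noteq> 0" using assms(3) by (simp add: T_def)
  have "y^2 = (S / T)^3 + A * (S / T)" using c by (simp add: S_def T_def A_def)
  then have y: "y^2 * T^4 = S * T * (S^2 + A * T^2)" using T
    by (simp add: field_simps power_numeral_reduce)
  then have nz: "S * T * (S^2 + A * T^2) \<noteq> 0" using T assms(2) by auto
  have "rat_of_int (4 * s * t * (s^2 + a * t^2)) = 4 * (S * T * (S^2 + A * T^2))"
    by (simp add: S_def T_def A_def)
  then have 1: "4 * s * t * (s^2 + a * t^2) \<noteq> 0" using nz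
    by (metis mult_eq_0_iff of_int_0 zero_neq_numeral)
  have "(((S / T)^2 - A) / (2 * y))^2 = (S^2 - A * T^2)^2 / (4 * (y^2 * T^4))"
    using T assms(2) by (simp add: field_simps power_numeral_reduce)
  also have "\<dots> = (S^2 - A * T^2)^2 / (4 * S * T * (S^2 + A * T^2))"
    unfolding y by (simp add: mult.assoc)
  finally have "(((S / T)^2 - A) / (2 * y))^2 =
      of_int ((s^2 - a * t^2)^2) / of_int (4 * s * t * (s^2 + a * t^2))"
    by (simp add: S_def T_def A_def)
  then show ?thesis
    using ec_add_self_Affine[OF c assms(2)] that[OF 1] unfolding S_def T_def A_def by metis
qed

lemma not_coprime_primeE:
  fixes m n :: int
  assumes "\<not> coprime m n"
  obtains p where "prime p" "p dvd m" "p dvd n"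
proof -
  obtain c where c: "c dvd m" "c dvd n" "\<not> is_unit c" using assms by (rule not_coprimeE)
  have "\<exists>p. p dvd c \<and> prime p"
  proof (cases "c = 0")
    case True
    moreover have "prime (2 :: int)" by simp
    ultimately show ?thesis by blast
  next
    case False
    then show ?thesis using c(3) prime_divisor_exists by blast
  qed
  then show ?thesis using that c dvd_trans by blast
qed

text \<open>A common prime divides neither \<open>a * t\<close> nor \<open>s\<close>, so it divides
  4 or both \<open>s^2 - a * t^2\<close> and \<open>s^2 + a * t^2\<close>, whose sum is
  \<open>2 * s^2\<close>. Hence it is 2, against the parity hypothesis. Keeping the factor
  \<open>a\<close> in the conclusion lets the statement be iterated.\<close>

lemma coprime_duplication:
  fixes a s t :: int
  assumes "odd (s^2 - a * t^2)" "coprime s (a * t)"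
  shows "coprime ((s^2 - a * t^2)^2) (a * (4 * s * t * (s^2 + a * t^2)))"
proof (rule ccontr)
  assume "\<not> ?thesis"
  then obtain p where p: "prime p" "p dvd (s^2 - a * t^2)^2"
    "p dvd a * (4 * s * t * (s^2 + a * t^2))"
    by (rule not_coprime_primeE)
  have d: "p dvd s^2 - a * t^2" using p prime_dvd_power by blast
  have at: "\<not> p dvd a * t"
  proof
    assume at: "p dvd a * t"
    then have "p dvd a * t^2" by (simp add: power2_eq_square flip: mult.assoc)
    then have "p dvd s^2" using d by (metis dvd_add diff_add_cancel)
    then have "p dvd s" using p(1) prime_dvd_power by blast
    then show False using at assms(2) p(1) coprime_common_divisor not_prime_unit by blast
  qed
  have s: "\<not> p dvd s"
  proof
    assume "p dvd s"
    then have "p dvd s^2" by (simp add: power2_eq_square)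
    then have "p dvd s^2 - (s^2 - a * t^2)" using d by (rule dvd_diff)
    then have "p dvd (a * t) * t" by (simp add: power2_eq_square mult.assoc)
    then show False using at p(1) by (auto simp: prime_dvd_mult_iff)
  qed
  have "p dvd 4 \<or> p dvd s^2 + a * t^2"
    using p(1,3) at s by (simp add: prime_dvd_mult_iff)
  then have "p dvd 2"
  proof
    assume "p dvd 4"
    then have "p dvd 2 * 2" by simp
    then show ?thesis using p(1) prime_dvd_mult_iff by blast
  next
    assume "p dvd s^2 + a * t^2"
    then have "p dvd (s^2 + a * t^2) + (s^2 - a * t^2)" using d by (rule dvd_add)
    then have "p dvd 2 * s^2" by simp
    then show ?thesis using p(1) s by (simp add: prime_dvd_mult_iff prime_dvd_power_iff)
  qed
  then have "p = 2" using p(1) primes_dvd_imp_eq[of p 2] by simp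
  then show False using d assms(1) by simp
qed

lemma norm_duplication_bounds:
  fixes a s t :: real
  defines "N \<equiv> s^2 + \<bar>a\<bar> * t^2"
    and "N' \<equiv> ((s^2 - a * t^2)^2)^2 + \<bar>a\<bar> * (4 * s * t * (s^2 + a * t^2))^2"
  shows "N^4 \<le> N'" "N' \<le> 5 * N^4"
proof -
  \<comment> \<open>With \<open>q = 4 X Y\<close>, the norm \<open>N'\<close> is \<open>(N^2 + q)^2\<close> for \<open>a \<ge> 0\<close>
    and \<open>N^4 + 4 q (N^2 - q)\<close> for \<open>a < 0\<close>.\<close>
  define X Y where "X = s^2" and "Y = \<bar>a\<bar> * t^2"
  have XY: "X \<ge> 0" "Y \<ge> 0" by (simp_all add: X_def Y_def)
  have N: "N = X + Y" by (simp add: N_def X_def Y_def)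
  have q: "4 * X * Y \<le> N^2" "0 \<le> 4 * X * Y" using XY N
    by (simp_all add: power2_sum) (use sum_squares_bound[of X Y] in simp)
  have "N^4 \<le> N' \<and> N' \<le> 5 * N^4"
  proof (cases "a \<ge> 0")
    case True
    then have "N' = (N^2 + 4 * X * Y)^2"
      unfolding N N'_def X_def Y_def by simp algebra
    moreover have "(N^2)^2 \<le> (N^2 + 4 * X * Y)^2" "(N^2 + 4 * X * Y)^2 \<le> (N^2 + N^2)^2"
      using q by (intro power_mono; simp)+
    ultimately show ?thesis by (simp add: power_mult_distrib)
  next
    case False
    then have "N' = N^4 + 4 * (4 * X * Y) * (X - Y)^2"
      unfolding N N'_def X_def Y_def by simp algebra
    moreover have "(X - Y)^2 = N^2 - 4 * X * Y" unfolding N by algebra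
    then have "(X - Y)^2 \<le> N^2" using q by simp
    then have "(4 * X * Y) * (X - Y)^2 \<le> N^2 * N^2"
      using q by (intro mult_mono) auto
    ultimately show ?thesis using q by (simp add: power_numeral_reduce)
  qed
  then show "N^4 \<le> N'" "N' \<le> 5 * N^4" by auto
qed

section \<open>Existence of the height limit and its lower bound\<close>

text \<open>The lower growth bound makes the scaled logarithms increase, so their limit is at least
  the first term. The upper bound serves only for boundedness, that is, for the existence of the
  limit.\<close>

lemma quartic_growth_limit:
  fixes N :: "nat \<Rightarrow> real"
  assumes N: "\<And>n. N n \<ge> 1" "\<And>n. N n ^ 4 \<le> N (Suc n)" "\<And>n. N (Suc n) \<le> c * N n ^ 4"
    and c: "c \<ge> 1"
  obtains L where "(\<lambda>n. ln (N n) / 4 ^ n) \<longlonglongrightarrow> L" "ln (N 0) \<le> L"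
proof -
  define l where "l n = ln (N n) / 4 ^ n" for n
  have pos: "N n > 0" for n using N(1)[of n] by simp
  have "4 * ln (N n) \<le> ln (N (Suc n))" for n
  proof -
    have "ln (N n ^ 4) \<le> ln (N (Suc n))" using N(2)[of n] pos[of n] pos[of "Suc n"]
      by (subst ln_le_cancel_iff) auto
    then show ?thesis using pos by (simp add: ln_realpow)
  qed
  then have inc: "incseq l" unfolding l_def by (intro incseq_SucI) (simp add: field_simps)
  have "ln (N (Suc n)) \<le> ln c + 4 * ln (N n)" for n
  proof -
    have "ln (N (Suc n)) \<le> ln (c * N n ^ 4)"
      using N(3)[of n] pos[of n] pos[of "Suc n"] c
      by (subst ln_le_cancel_iff) (auto intro!: mult_pos_pos)
    then show ?thesis using pos[of n] c by (simp add: ln_mult ln_realpow)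
  qed
  then have "ln (N (Suc n)) * (9 * 4 ^ n) \<le> (ln c + 4 * ln (N n)) * (9 * 4 ^ n)" for n
    by (intro mult_right_mono) auto
  \<comment> \<open>The correction is the geometric tail of the errors \<open>ln c / 4 ^ k\<close>
    over all \<open>k > n\<close>, which explains the 3.\<close>
  then have "decseq (\<lambda>n. l n + ln c / (3 * 4 ^ n))"
    unfolding l_def by (intro decseq_SucI) (simp add: field_simps)
  then have "l n + ln c / (3 * 4 ^ n) \<le> l 0 + ln c / (3 * 4 ^ 0)" for n
    by (auto dest: decseqD)
  moreover have "0 \<le> ln c / (3 * 4 ^ n)" for n using c by simp
  ultimately have "l n \<le> l 0 + ln c / (3 * 4 ^ 0)" for n
    by (meson add_increasing2 order_refl order_trans)
  then obtain L where "l \<longlonglongrightarrow> L" "\<And>n. l n \<le> L"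
    using incseq_convergent[OF inc] by metis
  moreover have "l = (\<lambda>n. ln (N n) / 4 ^ n)" by (simp add: l_def fun_eq_iff)
  ultimately show ?thesis using that[of L] by (metis div_by_1 power_0)
qed

lemma rat_height_fraction:
  assumes "coprime s t" "t \<noteq> 0"
  shows "rat_height (of_int s / of_int t) = ln (real_of_int (max \<bar>s\<bar> \<bar>t\<bar>))"
proof -
  have "quotient_of (of_int s / of_int t) = (if t > 0 then (s, t) else (- s, - t))"
    using assms by (simp add: Fract_of_int_quotient[symmetric] quotient_of_Fract Rat.normalize_def
        coprime_iff_gcd_eq_1)
  then show ?thesis by (simp add: rat_height_def)
qed

text \<open>\<open>N\<close> lies between \<open>M^2\<close> and
  \<open>(1 + \<bar>a\<bar>) * M^2\<close>. The constant disappears after division by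
  \<open>4 ^ n\<close>, and the square accounts for the factor \<open>1/2\<close>.\<close>

lemma fraction_height_limit:
  fixes s t :: "nat \<Rightarrow> int"
  assumes a: "a \<noteq> 0" and g: "even (t 0)" "coprime (s 0) (a * t 0)" and t: "\<And>n. t n \<noteq> 0"
    and step: "\<And>n. s (Suc n) = (s n ^ 2 - a * t n ^ 2) ^ 2"
      "\<And>n. t (Suc n) = 4 * s n * t n * (s n ^ 2 + a * t n ^ 2)"
  obtains L where "(\<lambda>n. rat_height (of_int (s n) / of_int (t n)) / 4 ^ n) \<longlonglongrightarrow> L"
    "1/2 * ln (real_of_int (s 0 ^ 2 + \<bar>a\<bar> * t 0 ^ 2)) \<le> L"
proof -
  \<comment> \<open>The invariant keeps the fraction in lowest terms, so \<open>rat_height\<close>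
    reads off \<open>M\<close>. Even \<open>t n\<close> forces odd \<open>s n\<close>, hence the
    parity that \<open>coprime_duplication\<close> asks for.\<close>
  have co: "even (t n) \<and> coprime (s n) (a * t n)" for n
  proof (induction n)
    case (Suc n)
    then have "odd (s n)" using coprime_common_divisor[of "s n" "a * t n" 2] by auto
    then show ?case using coprime_duplication[of "s n" a "t n"] Suc by (simp add: step)
  qed (use g in simp)
  define N where "N n = real_of_int (s n ^ 2 + \<bar>a\<bar> * t n ^ 2)" for n
  define M where "M n = real_of_int (max \<bar>s n\<bar> \<bar>t n\<bar>)" for n
  have M1: "M n \<ge> 1" for n using t[of n] by (simp add: M_def)
  have lo: "M n ^ 2 \<le> N n" for n
  proof -
    have "\<bar>t n\<bar>^2 \<le> \<bar>a\<bar> * t n ^ 2"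
      using a mult_right_mono[of 1 "\<bar>a\<bar>" "t n ^ 2"] by simp
    then have "max \<bar>s n\<bar> \<bar>t n\<bar> ^ 2 \<le> s n ^ 2 + \<bar>a\<bar> * t n ^ 2"
      by (cases "\<bar>s n\<bar> \<le> \<bar>t n\<bar>") (simp_all add: max_def add_increasing)
    then show ?thesis unfolding M_def N_def by (metis of_int_le_iff of_int_power)
  qed
  have hi: "N n \<le> (1 + \<bar>a\<bar>) * M n ^ 2" for n
  proof -
    have "s n ^ 2 \<le> max \<bar>s n\<bar> \<bar>t n\<bar> ^ 2" "t n ^ 2 \<le> max \<bar>s n\<bar> \<bar>t n\<bar> ^ 2"
      by (simp_all flip: abs_le_square_iff)
    then have "s n ^ 2 + \<bar>a\<bar> * t n ^ 2 \<le> (1 + \<bar>a\<bar>) * max \<bar>s n\<bar> \<bar>t n\<bar> ^ 2"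
      by (simp add: distrib_right add_mono mult_left_mono)
    then have "real_of_int (s n ^ 2 + \<bar>a\<bar> * t n ^ 2) \<le>
        real_of_int ((1 + \<bar>a\<bar>) * max \<bar>s n\<bar> \<bar>t n\<bar> ^ 2)" by (simp only: of_int_le_iff)
    then show ?thesis unfolding M_def N_def by simp
  qed
  have N1: "N n \<ge> 1" for n using lo[of n] M1[of n] by (meson one_le_power order_trans)
  have "N n ^ 4 \<le> N (Suc n)" "N (Suc n) \<le> 5 * N n ^ 4" for n
    using norm_duplication_bounds[of "of_int (s n)" "of_int a" "of_int (t n)"]
    by (simp_all add: N_def step)
  then obtain L where L: "(\<lambda>n. ln (N n) / 4 ^ n) \<longlonglongrightarrow> L" "ln (N 0) \<le> L"
    using quartic_growth_limit[of N 5] N1 by auto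
  have eq: "rat_height (of_int (s n) / of_int (t n)) = ln (M n)" for n
    using rat_height_fraction[of "s n" "t n"] co t by (simp add: M_def)
  define K where "K = ln (1 + \<bar>real_of_int a\<bar>)"
  have "2 * ln (M n) \<le> ln (N n)" for n
  proof -
    have "ln (M n ^ 2) \<le> ln (N n)" using lo[of n] M1[of n] N1[of n]
      by (subst ln_le_cancel_iff) auto
    then show ?thesis using M1[of n] by (simp add: ln_realpow)
  qed
  then have u: "ln (M n) / 4 ^ n \<le> 1/2 * (ln (N n) / 4 ^ n)" for n
    by (simp add: field_simps)
  have "ln (N n) \<le> K + 2 * ln (M n)" for n
  proof -
    have "ln (N n) \<le> ln ((1 + \<bar>real_of_int a\<bar>) * M n ^ 2)" using hi[of n] M1[of n] N1[of n]
      by (subst ln_le_cancel_iff) (auto intro!: mult_pos_pos)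
    also have "\<dots> = K + 2 * ln (M n)"
      using M1[of n] unfolding K_def by (subst ln_mult) (auto simp: ln_realpow)
    finally show ?thesis .
  qed
  then have "ln (N n) * 4 ^ n \<le> (K + 2 * ln (M n)) * 4 ^ n" for n
    by (intro mult_right_mono) auto
  then have l: "1/2 * (ln (N n) / 4 ^ n) - K / 2 * (1/4) ^ n \<le> ln (M n) / 4 ^ n" for n
    by (simp add: field_simps)
  have "(\<lambda>n. 1/2 * (ln (N n) / 4 ^ n) - K / 2 * (1/4) ^ n) \<longlonglongrightarrow> 1/2 * L - K / 2 * 0"
    by (intro tendsto_intros L LIMSEQ_power_zero) simp
  then have lim1: "(\<lambda>n. 1/2 * (ln (N n) / 4 ^ n) - K / 2 * (1/4) ^ n) \<longlonglongrightarrow> 1/2 * L"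
    by simp
  have lim2: "(\<lambda>n. 1/2 * (ln (N n) / 4 ^ n)) \<longlonglongrightarrow> 1/2 * L"
    by (intro tendsto_intros L)
  have "(\<lambda>n. ln (M n) / 4 ^ n) \<longlonglongrightarrow> 1/2 * L"
    by (rule tendsto_sandwich[OF always_eventually always_eventually lim1 lim2])
      (use l u in blast)+
  then show ?thesis using that[of "1/2 * L"] L(2) eq by (simp add: N_def)
qed

text \<open>The iterates of the integer map \<open>f\<close> give the abscissas of the successive
  doubles of \<open>Q\<close>. Every double is again nontorsion, so its ordinate is nonzero and no
  denominator vanishes.\<close>

lemma naive_height_limit_of_fraction:
  assumes a: "a \<noteq> 0" and Q: "on_curve a Q" "nontorsion a Q"
    and xQ: "Q = Affine (of_int s / of_int t) y" and g: "t \<noteq> 0" "even t" "coprime s (a * t)"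
  obtains L where "(\<lambda>n. naive_height (Q [^]\<^bsub>EC a\<^esub> ((2::nat) ^ n)) / 4 ^ n) \<longlonglongrightarrow> L"
    "1/2 * ln (real_of_int (s^2 + \<bar>a\<bar> * t^2)) \<le> L"
proof -
  define f where "f = (\<lambda>(s :: int, t). ((s^2 - a * t^2)^2, 4 * s * t * (s^2 + a * t^2)))"
  define S T where "S n = fst ((f ^^ n) (s, t))" and "T n = snd ((f ^^ n) (s, t))" for n
  define D where "D n = ((\<lambda>Q. ec_add a Q Q) ^^ n) Q" for n
  have st: "S (Suc n) = (S n ^ 2 - a * T n ^ 2) ^ 2"
    "T (Suc n) = 4 * S n * T n * (S n ^ 2 + a * T n ^ 2)" for n
    by (simp_all add: S_def T_def f_def case_prod_beta)
  have D: "on_curve a (D n) \<and> nontorsion a (D n)" for n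
    by (induction n) (use Q a ec_add_closed nontorsion_double in \<open>auto simp: D_def\<close>)
  have x: "T n \<noteq> 0 \<and> (\<exists>y. D n = Affine (of_int (S n) / of_int (T n)) y)" for n
  proof (induction n)
    case 0
    then show ?case using xQ g by (simp add: S_def T_def D_def)
  next
    case (Suc n)
    then obtain y where y: "D n = Affine (of_int (S n) / of_int (T n)) y" by auto
    then have "y \<noteq> 0" using nontorsion_Affine[of a "D n"] D by (metis ec_point.inject)
    moreover have "D (Suc n) = ec_add a (D n) (D n)" by (simp add: D_def)
    ultimately show ?case
      using ec_add_self_fraction[of a "S n" "T n" y] D[of n] Suc y st by metis
  qed
  have h: "naive_height (D n) = rat_height (of_int (S n) / of_int (T n))" for n
    using x[of n] by auto
  have 0: "S 0 = s" "T 0 = t" by (simp_all add: S_def T_def)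
  have g0: "even (T 0)" "coprime (S 0) (a * T 0)" using g 0 by simp_all
  have T0: "T n \<noteq> 0" for n using x by blast
  show ?thesis
  proof (rule fraction_height_limit[where s = S and t = T, OF a g0 T0 st])
    fix L
    assume "(\<lambda>n. rat_height (of_int (S n) / of_int (T n)) / 4 ^ n) \<longlonglongrightarrow> L"
      "1/2 * ln (real_of_int (S 0 ^ 2 + \<bar>a\<bar> * T 0 ^ 2)) \<le> L"
    then show ?thesis
      using that[of L] h EC_pow_two_power[OF a Q] unfolding 0 by (simp flip: D_def)
  qed
qed

text \<open>Doubling the point shifts the sequence by one index, which costs a factor 4.\<close>

lemma naive_height_limit_double:
  assumes a: "a \<noteq> 0" and P: "on_curve a P" "nontorsion a P"
    and "(\<lambda>n. naive_height (ec_add a P P [^]\<^bsub>EC a\<^esub> ((2::nat) ^ n)) / 4 ^ n) \<longlonglongrightarrow> L"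
  shows "(\<lambda>n. naive_height (P [^]\<^bsub>EC a\<^esub> ((2::nat) ^ n)) / 4 ^ n) \<longlonglongrightarrow> L / 4"
proof -
  have "naive_height (P [^]\<^bsub>EC a\<^esub> ((2::nat) ^ Suc n)) / 4 ^ Suc n =
      naive_height (ec_add a P P [^]\<^bsub>EC a\<^esub> ((2::nat) ^ n)) / 4 ^ n / 4" for n
    using EC_pow_double[OF a P, of "2 ^ n"] by simp
  then have "(\<lambda>n. naive_height (P [^]\<^bsub>EC a\<^esub> ((2::nat) ^ Suc n)) / 4 ^ Suc n) \<longlonglongrightarrow> L / 4"
    using tendsto_divide[OF assms(4) tendsto_const[of 4]] by (simp only:)
  then show ?thesis by (rule LIMSEQ_imp_Suc)
qed

section \<open>Integral coordinates and the arithmetic of \<open>x(2P)\<close>\<close>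

lemma rat_square_of_int:
  assumes "(r::rat)^2 = of_int k"
  obtains w where "r = of_int w"
proof -
  obtain p q where pq: "quotient_of r = (p, q)" by (cases "quotient_of r")
  have q: "q > 0" "coprime p q" and r: "r = of_int p / of_int q"
    using pq quotient_of_denom_pos quotient_of_coprime quotient_of_div by blast+
  have "(of_int p :: rat)^2 = of_int k * of_int q^2"
    using assms q(1) by (simp add: r power_divide field_simps)
  then have "p^2 = k * q^2" by (metis of_int_eq_iff of_int_mult of_int_power)
  then have "q dvd p^2" by (simp add: power2_eq_square)
  moreover have "coprime (p^2) q" using q(2) by simp
  ultimately have "is_unit q" using coprime_common_divisor[of "p^2" q q] by simp
  then have "q = 1" using q(1) by simp
  then show ?thesis using that[of p] r by simp
qed

text \<open>Since \<open>(y * v^2)^2\<close> is an integer, so is \<open>y * v^2\<close>. The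
  fraction for \<open>y\<close> may be unreduced, and nothing has to be known about whether
  \<open>v\<close> is a square.\<close>

lemma on_curve_coordinates:
  assumes c: "on_curve a (Affine x y)"
  obtains u v w where "x = of_int u / of_int v" "y = of_int w / of_int v^2" "v > 0"
    "coprime u v" "w^2 = u * v * (u^2 + a * v^2)"
proof -
  obtain u v where uv: "quotient_of x = (u, v)" by (cases "quotient_of x")
  have v: "v > 0" "coprime u v" and x: "x = of_int u / of_int v"
    using uv quotient_of_denom_pos quotient_of_coprime quotient_of_div by blast+
  have "(y * of_int v^2)^2 = (x^3 + of_int a * x) * of_int v^4"
    using c by (simp add: power_mult_distrib)
  also have "\<dots> = of_int (u * v * (u^2 + a * v^2))"
    using v(1) by (simp add: x field_simps power_numeral_reduce)
  finally have e: "(y * of_int v^2)^2 = of_int (u * v * (u^2 + a * v^2))" .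
  then obtain w where w: "y * of_int v^2 = of_int w" by (rule rat_square_of_int)
  have "w^2 = u * v * (u^2 + a * v^2)" using e unfolding w by (metis of_int_eq_iff of_int_power)
  moreover have "y = of_int w / of_int v^2" using w v(1) by (simp add: field_simps)
  ultimately show ?thesis using that x v by blast
qed

lemma odd_prime_not_dvd_double:
  fixes a u v w \<alpha> \<beta> p :: int
  assumes p: "prime p" "odd p" and a: "p dvd a" "\<not> p^4 dvd a"
    and uv: "coprime u v" and w: "w^2 = u * v * (u^2 + a * v^2)"
    and \<alpha>\<beta>: "\<alpha> * (2 * w) = \<beta> * (u^2 - a * v^2)" "coprime \<alpha> \<beta>"
  shows "\<not> p dvd \<alpha>"
proof
  assume \<alpha>: "p dvd \<alpha>"
  \<comment> \<open>Descent: the relations survive division by \<open>p\<close> and each round yields one more factor \<open>p\<close> of \<open>a\<close>.\<close>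
  have p0: "p \<noteq> 0" using p(1) by auto
  have p2: "\<not> p dvd 2"
  proof
    assume "p dvd 2"
    then have "p = 2" using p(1) primes_dvd_imp_eq[of p 2] by simp
    then show False using p(2) by simp
  qed
  have \<beta>: "\<not> p dvd \<beta>" using \<alpha> \<alpha>\<beta>(2) p(1) coprime_common_divisor not_prime_unit by blast
  have cancel: "p dvd X" if "\<alpha> * Y = \<beta> * X" for X Y
    using that \<alpha> \<beta> p(1) by (metis dvd_mult2 prime_dvd_mult_iff)
  have sq: "p dvd X" if "p dvd X^2" for X using that p(1) prime_dvd_power by blast
  have "p dvd u^2 - a * v^2" using cancel \<alpha>\<beta>(1) by blast
  then have "p dvd u^2" using a(1) by (metis diff_add_cancel dvd_add dvd_mult2)
  then have "p dvd u" by (rule sq)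
  then have v: "\<not> p dvd v" using uv p(1) coprime_common_divisor not_prime_unit by blast
  have v2: "p dvd X" if "p dvd X * v^2" for X
    using that v p(1) sq prime_dvd_mult_iff by blast
  obtain u1 where u1: "u = p * u1" using \<open>p dvd u\<close> by (rule dvdE)
  obtain a1 where a1: "a = p * a1" using a(1) by (rule dvdE)
  have w': "w^2 = p^2 * (u1 * v * (p * u1^2 + a1 * v^2))"
    unfolding w u1 a1 by algebra
  then have "p dvd w^2" by (simp add: power2_eq_square mult.assoc)
  then obtain w1 where w1: "w = p * w1" using sq by blast
  have w1': "w1^2 = u1 * v * (p * u1^2 + a1 * v^2)"
    using w' p0 by (simp add: w1 power_mult_distrib)
  have "p * (\<alpha> * (2 * w1)) = p * (\<beta> * (p * u1^2 - a1 * v^2))"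
    using \<alpha>\<beta>(1) unfolding w1 u1 a1 by algebra
  then have e1: "\<alpha> * (2 * w1) = \<beta> * (p * u1^2 - a1 * v^2)" using p0 by simp
  then have "p dvd p * u1^2 - a1 * v^2" by (rule cancel)
  then have "p dvd p * u1^2 - (p * u1^2 - a1 * v^2)" by (rule dvd_diff[OF dvd_triv_left])
  then have "p dvd a1 * v^2" by simp
  then have "p dvd a1" by (rule v2)
  then obtain a2 where a2: "a1 = p * a2" by (rule dvdE)
  have "p dvd w1^2" unfolding w1' a2 by (simp add: algebra_simps)
  then obtain w2 where w2: "w1 = p * w2" using sq by blast
  have "p * (p * w2^2) = p * (u1 * v * (u1^2 + a2 * v^2))"
    using w1' unfolding w2 a2 by algebra
  then have w2': "p * w2^2 = u1 * v * (u1^2 + a2 * v^2)" using p0 by simp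
  have "p * (\<alpha> * (2 * w2)) = p * (\<beta> * (u1^2 - a2 * v^2))"
    using e1 unfolding w2 a2 by algebra
  then have e2: "\<alpha> * (2 * w2) = \<beta> * (u1^2 - a2 * v^2)" using p0 by simp
  then have d2: "p dvd u1^2 - a2 * v^2" by (rule cancel)
  have "p dvd u1 * v * (u1^2 + a2 * v^2)" unfolding w2'[symmetric] by simp
  \<comment> \<open>Both alternatives give \<open>p dvd u1\<close>: in the second, \<open>p\<close>
    divides \<open>u1^2 + a2 * v^2\<close> and \<open>u1^2 - a2 * v^2\<close>, hence
    \<open>2 * u1^2\<close>. This is where \<open>p\<close> must be odd.\<close>
  then have "p dvd u1 \<or> p dvd u1^2 + a2 * v^2" using v p(1) by (simp add: prime_dvd_mult_iff)
  then have pu1: "p dvd u1"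
  proof
    assume "p dvd u1^2 + a2 * v^2"
    then have "p dvd (u1^2 + a2 * v^2) + (u1^2 - a2 * v^2)" using d2 by (rule dvd_add)
    then have "p dvd 2 * u1^2" by simp
    then show ?thesis using p2 p(1) sq prime_dvd_mult_iff by blast
  qed
  then have "p dvd u1^2" by (simp add: power2_eq_square)
  then have "p dvd u1^2 - (u1^2 - a2 * v^2)" using d2 by (rule dvd_diff)
  then have "p dvd a2 * v^2" by simp
  then have "p dvd a2" by (rule v2)
  then obtain a3 where a3: "a2 = p * a3" by (rule dvdE)
  obtain u2 where u2: "u1 = p * u2" using pu1 by (rule dvdE)
  have "p * w2^2 = p * (p * (u2 * v * (p * u2^2 + a3 * v^2)))"
    using w2' unfolding u2 a3 by algebra
  then have "p dvd w2^2" using p0 by simp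
  then obtain w3 where w3: "w2 = p * w3" using sq by blast
  have "p * (\<alpha> * (2 * w3)) = p * (\<beta> * (p * u2^2 - a3 * v^2))"
    using e2 unfolding w3 u2 a3 by algebra
  then have "\<alpha> * (2 * w3) = \<beta> * (p * u2^2 - a3 * v^2)" using p0 by simp
  then have "p dvd p * u2^2 - a3 * v^2" by (rule cancel)
  then have "p dvd p * u2^2 - (p * u2^2 - a3 * v^2)" by (rule dvd_diff[OF dvd_triv_left])
  then have "p dvd a3 * v^2" by simp
  then have "p dvd a3" by (rule v2)
  then have "p^4 dvd a" unfolding a1 a2 a3
    by (auto elim!: dvdE simp: power_numeral_reduce mult.assoc)
  then show False using a(2) by simp
qed

lemma odd_square_mod_8:
  fixes x :: int
  assumes "odd x"
  shows "x^2 mod 8 = 1"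
proof -
  have "x mod 8 = 1 \<or> x mod 8 = 3 \<or> x mod 8 = 5 \<or> x mod 8 = 7" using assms by presburger
  moreover have "x^2 mod 8 = (x mod 8)^2 mod 8" by (simp add: power_mod)
  ultimately show ?thesis by auto
qed

text \<open>Odd squares are 1 modulo 8, so modulo a divisor of 8 the forms may be evaluated at
  \<open>u = v = 1\<close>.\<close>

lemma dvd_odd_squares_iff:
  fixes u v c n :: int
  assumes "odd u" "odd v" "n dvd 8"
  shows "n dvd u^2 + c * v^2 \<longleftrightarrow> n dvd 1 + c" "n dvd u^2 - c * v^2 \<longleftrightarrow> n dvd 1 - c"
proof -
  have sq: "n dvd x^2 - 1" if "odd x" for x :: int
    using odd_square_mod_8[OF that] assms(3) dvd_trans by (metis mod_eq_dvd_iff mod_pos_pos_trivial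
        zero_le_one one_less_numeral_iff semiring_norm(76))
  have *: "n dvd u^2 + d * v^2 \<longleftrightarrow> n dvd 1 + d" for d
  proof -
    have "n dvd (u^2 - 1) + d * (v^2 - 1)" using sq assms(1,2) by simp
    moreover have "u^2 + d * v^2 = ((u^2 - 1) + d * (v^2 - 1)) + (1 + d)"
      by (simp add: algebra_simps)
    ultimately show ?thesis by (simp only: dvd_add_right_iff)
  qed
  show "n dvd u^2 + c * v^2 \<longleftrightarrow> n dvd 1 + c" "n dvd u^2 - c * v^2 \<longleftrightarrow> n dvd 1 - c"
    using *[of c] *[of "- c"] by simp_all
qed

lemma four_dvd_of_eight_dvd_square:
  fixes w :: int
  assumes "8 dvd w^2"
  shows "4 dvd w"
proof -
  have "even (w^2)" using assms by (rule dvd_trans[rotated]) simp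
  then obtain w1 where w1: "w = 2 * w1" by (auto elim: evenE)
  obtain k where "w^2 = 8 * k" using assms by (rule dvdE)
  then have "w1^2 = 2 * k" by (simp add: w1 power_mult_distrib)
  then have "even (w1^2)" by simp
  then have "even w1" by simp
  then show ?thesis using w1 by (auto elim!: evenE)
qed

text \<open>For odd \<open>w\<close> the left side is 2 modulo 16, a value that no odd residues of
  \<open>u\<close> and \<open>v\<close> produce on the right. With \<open>a = 4 * b\<close> this
  separates 20 and 36 from 4 and 52 modulo 64.\<close>

lemma mod_16_obstruction:
  fixes b u v w :: int
  assumes "odd u" "odd v" and "2 * w^2 = u * v * (u^2 + b * v^2)" "odd w"
  shows "b mod 16 \<noteq> 5" "b mod 16 \<noteq> 9"
proof -
  have "((u mod 16) * (v mod 16) * ((u mod 16)^2 + (b mod 16) * (v mod 16)^2)) mod 16 =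
      2 * w^2 mod 16"
    unfolding assms(3) by (intro mod_mult_cong mod_add_cong) (simp_all add: power_mod)
  moreover have "2 * w^2 mod 16 = 2" using odd_square_mod_8[OF assms(4)] by presburger
  ultimately have e:
    "((u mod 16) * (v mod 16) * ((u mod 16)^2 + (b mod 16) * (v mod 16)^2)) mod 16 = 2"
    by simp
  have "u mod 16 \<in> {1,3,5,7,9,11,13,15}" using assms(1) by simp presburger
  moreover have "v mod 16 \<in> {1,3,5,7,9,11,13,15}" using assms(2) by simp presburger
  ultimately show "b mod 16 \<noteq> 5" "b mod 16 \<noteq> 9" using e by auto
qed

lemma four_dvd_odd_mult_iff:
  fixes x y :: int
  assumes "odd x"
  shows "4 dvd x * y \<longleftrightarrow> 4 dvd y"
proof -
  have "coprime ((2::int)^2) x" using assms by (simp only: coprime_power_left_iff) simp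
  then show ?thesis by (simp add: coprime_dvd_mult_right_iff)
qed

lemma four_dvd_double_iff: "4 dvd 2 * x \<longleftrightarrow> even (x :: int)"
  by presburger

text \<open>Powers of 2 are compared in the two relations: a small power in \<beta> forces a large
  one in \<open>u^2 - a * v^2\<close>, while the square \<open>w^2\<close> forces one in
  \<open>u^2 + a * v^2\<close>. The two demands conflict for most residues of
  \<open>a\<close>.\<close>

lemma denominator_double_two_adic:
  fixes a u v w \<alpha> \<beta> :: int
  assumes a: "\<not> 16 dvd a" and uv: "coprime u v" and w: "w^2 = u * v * (u^2 + a * v^2)"
    and \<alpha>\<beta>: "\<alpha> * (2 * w) = \<beta> * (u^2 - a * v^2)"
  shows "odd \<beta> \<Longrightarrow> even \<alpha> \<and> a mod 64 \<in> {4, 52}"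
    and "coprime \<alpha> \<beta> \<Longrightarrow> a mod 16 \<in> {1, 5, 7, 9, 13, 15} \<Longrightarrow> 4 dvd \<beta>"
proof -
  have nuv: "odd u \<or> odd v" using uv coprime_common_divisor[of u v 2] by auto
  \<comment> \<open>For odd \<open>a\<close>, both \<open>1 - a\<close> and \<open>1 + a\<close>
    would be divisible by 4.\<close>
  have even_a: "even a" if \<beta>: "odd \<beta>"
  proof (rule ccontr)
    assume oa: "odd a"
    have "even (\<beta> * (u^2 - a * v^2))" unfolding \<alpha>\<beta>[symmetric] by simp
    then have "odd u" "odd v" using \<beta> oa nuv by auto
    then have "even (w^2)" unfolding w using oa by simp
    then obtain w1 where w1: "w = 2 * w1" by (auto elim: evenE)
    have "4 dvd \<beta> * (u^2 - a * v^2)" unfolding \<alpha>\<beta>[symmetric] w1 by simp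
    then have "4 dvd u^2 - a * v^2" using \<beta> by (simp add: four_dvd_odd_mult_iff)
    then have "4 dvd 1 - a" using \<open>odd u\<close> \<open>odd v\<close> by (simp add: dvd_odd_squares_iff)
    then have "\<not> 4 dvd 1 + a" by presburger
    then have "\<not> 4 dvd u^2 + a * v^2" using \<open>odd u\<close> \<open>odd v\<close> by (simp add: dvd_odd_squares_iff)
    moreover have "4 dvd (u * v) * (u^2 + a * v^2)" unfolding w[symmetric] w1 by simp
    ultimately show False using \<open>odd u\<close> \<open>odd v\<close> by (simp add: four_dvd_odd_mult_iff)
  qed
  show "even \<alpha> \<and> a mod 64 \<in> {4, 52}" if \<beta>: "odd \<beta>"
  proof -
    obtain c where c: "a = 2 * c" using even_a[OF \<beta>] by (auto elim: evenE)
    have "even (\<beta> * (u^2 - a * v^2))" unfolding \<alpha>\<beta>[symmetric] by simp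
    then have "even u" using \<beta> c by simp
    then obtain u1 where u1: "u = 2 * u1" by (auto elim: evenE)
    have v: "odd v" using nuv u1 by simp
    have e1: "\<alpha> * w = \<beta> * (2 * u1^2 - c * v^2)"
      using \<alpha>\<beta> unfolding u1 c by (simp add: power_mult_distrib algebra_simps)
    have w': "w^2 = 4 * (u1 * v * (2 * u1^2 + c * v^2))" unfolding w u1 c by algebra
    then have "even (w^2)" by simp
    then have "even (\<alpha> * w)" by simp
    then have "even c" using \<beta> v unfolding e1 by simp
    then obtain b where b: "c = 2 * b" by (auto elim: evenE)
    have w'': "w^2 = 8 * (u1 * v * (u1^2 + b * v^2))" unfolding w' b by algebra
    then have "4 dvd w" by (intro four_dvd_of_eight_dvd_square) simp
    then obtain w1 where w1: "w = 4 * w1" by (rule dvdE)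
    have w1': "2 * w1^2 = u1 * v * (u1^2 + b * v^2)"
      using w'' unfolding w1 by (simp add: power_mult_distrib)
    have e2: "\<alpha> * (2 * w1) = \<beta> * (u1^2 - b * v^2)"
      using e1 unfolding w1 b by (simp add: algebra_simps)
    have ev: "even (u1^2 - b * v^2)" using \<beta> e2 by (metis dvd_mult even_mult_iff dvd_triv_left)
    \<comment> \<open>If \<open>b = 2 * d\<close>, then \<open>d\<close> is odd because 16 does not
      divide \<open>a\<close>; one further division by 2 makes \<open>w1\<close> both even and
      odd.\<close>
    have "odd b"
    proof
      assume "even b"
      then obtain d where d: "b = 2 * d" by (auto elim: evenE)
      then have "even u1" using ev by simp
      then obtain u2 where u2: "u1 = 2 * u2" by (auto elim: evenE)
      have "odd d" using a c b d by auto
      have "w1^2 = 2 * (u2 * v * (2 * u2^2 + d * v^2))" using w1' unfolding u2 d by algebra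
      then have "even (w1^2)" by simp
      moreover have "\<alpha> * w1 = \<beta> * (2 * u2^2 - d * v^2)"
        using e2 unfolding u2 d by (simp add: power_mult_distrib algebra_simps)
      then have "odd (\<alpha> * w1)" using \<beta> v \<open>odd d\<close> by simp
      ultimately show False by simp
    qed
    then have "odd u1" using ev v by simp
    have m: "4 dvd u1^2 + b * v^2 \<longleftrightarrow> 4 dvd 1 + b" "4 dvd u1^2 - b * v^2 \<longleftrightarrow> 4 dvd 1 - b"
      using v \<open>odd u1\<close> by (simp_all add: dvd_odd_squares_iff)
    \<comment> \<open>If \<open>b\<close> were 3 modulo 4, then \<open>w1\<close> would be even, so
      4 would divide \<open>u1^2 - b * v^2\<close>, which is 2 modulo 4.\<close>
    have "b mod 4 = 1"
    proof (rule ccontr)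
      assume "b mod 4 \<noteq> 1"
      then have "4 dvd 1 + b" "\<not> 4 dvd 1 - b" using \<open>odd b\<close> by presburger+
      then have "4 dvd u1^2 + b * v^2" "\<not> 4 dvd u1^2 - b * v^2"
        using m by simp_all
      then have "4 dvd 2 * w1^2" unfolding w1' by simp
      then have "even w1" by (simp add: four_dvd_double_iff)
      then have "4 dvd \<beta> * (u1^2 - b * v^2)" unfolding e2[symmetric] by auto
      then show False using \<beta> \<open>\<not> 4 dvd u1^2 - b * v^2\<close>
        by (simp add: four_dvd_odd_mult_iff)
    qed
    have "odd w1"
    proof
      assume "even w1"
      then have "4 dvd 2 * w1^2" by (auto elim!: evenE)
      then have "4 dvd (u1 * v) * (u1^2 + b * v^2)" unfolding w1' .
      then have "4 dvd u1^2 + b * v^2" using \<open>odd u1\<close> v by (simp add: four_dvd_odd_mult_iff)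
      then show False using m(1) \<open>b mod 4 = 1\<close> by simp presburger
    qed
    have "4 dvd u1^2 - b * v^2" using m(2) \<open>b mod 4 = 1\<close> by simp presburger
    then have "4 dvd \<alpha> * (2 * w1)" unfolding e2 by simp
    then have "4 dvd 2 * (\<alpha> * w1)" by (simp add: mult.left_commute)
    then have "even \<alpha>" using \<open>odd w1\<close> by (simp add: four_dvd_double_iff)
    moreover have "b mod 16 \<noteq> 5" "b mod 16 \<noteq> 9"
      using mod_16_obstruction[OF \<open>odd u1\<close> v w1' \<open>odd w1\<close>] by auto
    then have "b mod 16 = 1 \<or> b mod 16 = 13" using \<open>b mod 4 = 1\<close> by presburger
    moreover have "a mod 64 = 4 * (b mod 16)" unfolding c b by (simp add: mult_mod_right)
    ultimately show ?thesis by auto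
  qed
  show "4 dvd \<beta>" if co: "coprime \<alpha> \<beta>" and a16: "a mod 16 \<in> {1, 5, 7, 9, 13, 15}"
  proof (rule ccontr)
    assume n4: "\<not> 4 dvd \<beta>"
    have oa: "odd a" using a16 by (auto; presburger)
    then have "even \<beta>" using even_a by auto
    then obtain b where b: "\<beta> = 2 * b" by (auto elim: evenE)
    have "odd b" using n4 b by auto
    have "odd \<alpha>" using co \<open>even \<beta>\<close> coprime_common_divisor[of \<alpha> \<beta> 2] by auto
    have e: "\<alpha> * w = b * (u^2 - a * v^2)" using \<alpha>\<beta> b by simp
    have "odd u \<and> odd v"
    proof (rule ccontr)
      assume "\<not> (odd u \<and> odd v)"
      then have "even (w^2)" "odd (b * (u^2 - a * v^2))"
        using nuv oa \<open>odd b\<close> unfolding w by auto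
      then show False unfolding e[symmetric] by simp
    qed
    then have m: "n dvd u^2 + a * v^2 \<longleftrightarrow> n dvd 1 + a" "n dvd u^2 - a * v^2 \<longleftrightarrow> n dvd 1 - a"
      if "n dvd 8" for n
      using that by (simp_all add: dvd_odd_squares_iff)
    have "even (u^2 + a * v^2)" using \<open>odd u \<and> odd v\<close> oa by simp
    then have "even (w^2)" unfolding w by simp
    then have "4 dvd w^2" by (auto elim!: evenE)
    then have "4 dvd (u * v) * (u^2 + a * v^2)" unfolding w .
    then have "4 dvd u^2 + a * v^2" using \<open>odd u \<and> odd v\<close> by (simp add: four_dvd_odd_mult_iff)
    then have "4 dvd 1 + a" using m(1)[of 4] by simp
    \<comment> \<open>Of the listed residues only 7 and 15 are 3 modulo 4; the residues 3 and 11 are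
      not in the list.\<close>
    then have "8 dvd 1 + a" using a16 by (auto; presburger)
    then have "8 dvd u^2 + a * v^2" using m(1)[of 8] by simp
    then have "8 dvd w^2" unfolding w by simp
    then have "4 dvd w" by (rule four_dvd_of_eight_dvd_square)
    then have "4 dvd b * (u^2 - a * v^2)" unfolding e[symmetric] by simp
    then have "4 dvd u^2 - a * v^2" using \<open>odd b\<close> by (simp add: four_dvd_odd_mult_iff)
    then have "4 dvd 1 - a" using m(2)[of 4] by simp
    then show False using \<open>8 dvd 1 + a\<close> by presburger
  qed
qed

lemma double_coordinates:
  assumes f: "fourth_power_free a" and P: "on_curve a P" "nontorsion a P"
  obtains \<alpha> \<beta> y where
    "ec_add a P P = Affine (of_int (\<alpha>^2) / of_int (\<beta>^2)) y"
    "\<beta> > 0" "coprime \<alpha> \<beta>"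
    "\<And>p. prime p \<Longrightarrow> odd p \<Longrightarrow> p dvd a \<Longrightarrow> \<not> p dvd \<alpha>"
    "odd \<beta> \<Longrightarrow> even \<alpha> \<and> a mod 64 \<in> {4, 52}"
    "a mod 16 \<in> {1, 5, 7, 9, 13, 15} \<Longrightarrow> 4 dvd \<beta>"
    "\<alpha> \<noteq> 0" "0 < \<alpha>^4 + a * \<beta>^4"
proof -
  have a0: "a \<noteq> 0" and a4: "\<And>p. prime p \<Longrightarrow> \<not> p^4 dvd a"
    using f by (auto simp: fourth_power_free_def)
  have a16: "\<not> 16 dvd a" using a4[of 2] by simp
  obtain x y where xy: "P = Affine x y" "y \<noteq> 0" using nontorsion_Affine[OF P(2)] .
  obtain u v w where x: "x = of_int u / of_int v" and y: "y = of_int w / of_int v^2"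
    and v: "v > 0" and uv: "coprime u v" and w: "w^2 = u * v * (u^2 + a * v^2)"
    using on_curve_coordinates[of a x y] P(1) xy(1) by metis
  have w0: "w \<noteq> 0" using xy(2) y by auto
  define r :: rat where "r = (x^2 - of_int a) / (2 * y)"
  obtain y' where y': "ec_add a P P = Affine (r^2) y'"
    using ec_add_self_Affine[of a x y] P(1) xy unfolding r_def by metis
  obtain \<alpha> \<beta> where q: "quotient_of r = (\<alpha>, \<beta>)" by (cases "quotient_of r")
  have \<beta>: "\<beta> > 0" and co: "coprime \<alpha> \<beta>" and r: "r = of_int \<alpha> / of_int \<beta>"
    using q quotient_of_denom_pos quotient_of_coprime quotient_of_div by blast+
  have "r = of_int (u^2 - a * v^2) / of_int (2 * w)"
    unfolding r_def x y using v w0 by (simp add: field_simps)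
  then have "rat_of_int (\<alpha> * (2 * w)) = of_int (\<beta> * (u^2 - a * v^2))"
    using r \<beta> w0 by (simp add: field_simps)
  then have e: "\<alpha> * (2 * w) = \<beta> * (u^2 - a * v^2)" by (simp only: of_int_eq_iff)
  have "on_curve a (ec_add a P P)" "nontorsion a (ec_add a P P)"
    using ec_add_closed nontorsion_double a0 P by auto
  then have "y'^2 = (r^2)^3 + of_int a * r^2" "y' \<noteq> 0"
    using y' nontorsion_Affine[of a "ec_add a P P"] by (simp, metis ec_point.inject)
  moreover have "r^2 * (r^4 + of_int a) = (r^2)^3 + of_int a * r^2"
    by (simp add: algebra_simps flip: power_mult power_add)
  \<comment> \<open>This product is the square of the nonzero ordinate of \<open>2P\<close>. For
    negative \<open>a\<close> its positivity supplies the extra factor 2 in the final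
    estimate.\<close>
  ultimately have "r^2 * (r^4 + of_int a) > 0" by (metis zero_less_power2)
  then have "r^4 + of_int a > 0" by (simp add: zero_less_mult_iff)
  then have "(r^4 + of_int a) * of_int \<beta>^4 > 0" using \<beta> by simp
  also have "(r^4 + of_int a) * of_int \<beta>^4 = of_int (\<alpha>^4 + a * \<beta>^4)"
    using \<beta> unfolding r by (simp add: power_divide distrib_right)
  finally have "0 < \<alpha>^4 + a * \<beta>^4" by (simp only: of_int_0_less_iff)
  moreover have "\<alpha> \<noteq> 0" using \<open>r^2 * (r^4 + of_int a) > 0\<close> r by auto
  moreover have "ec_add a P P = Affine (of_int (\<alpha>^2) / of_int (\<beta>^2)) y'"
    using y' by (simp add: r power_divide)
  moreover have "\<And>p. prime p \<Longrightarrow> odd p \<Longrightarrow> p dvd a \<Longrightarrow> \<not> p dvd \<alpha>"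
    using odd_prime_not_dvd_double[OF _ _ _ a4 uv w e co] by blast
  ultimately show ?thesis
    using that \<beta> co denominator_double_two_adic[OF a16 uv w e] by blast
qed

section \<open>Height bounds and the constants\<close>

text \<open>The factor \<open>1/16\<close> combines \<open>1/2\<close> from the norm being
  quadratic, \<open>1/4\<close> from passing from \<open>2P\<close> to \<open>P\<close>, and
  \<open>1/2\<close> from the normalisation.\<close>

lemma canonical_height_double_le:
  assumes a: "a \<noteq> 0" and P: "on_curve a P" "nontorsion a P"
    and xQ: "ec_add a P P = Affine (of_int s / of_int t) y"
    and g: "t \<noteq> 0" "even t" "coprime s (a * t)"
  shows "1/16 * ln (real_of_int (s^2 + \<bar>a\<bar> * t^2)) \<le> canonical_height a P"
proof -
  obtain L where L: "1/2 * ln (real_of_int (s^2 + \<bar>a\<bar> * t^2)) \<le> L"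
    "(\<lambda>n. naive_height (ec_add a P P [^]\<^bsub>EC a\<^esub> ((2::nat) ^ n)) / 4 ^ n) \<longlonglongrightarrow> L"
    using naive_height_limit_of_fraction[OF a ec_add_closed[OF P(1) P(1)] nontorsion_double[OF a P] xQ g]
    by metis
  then have "canonical_height a P = 1/2 * (L / 4)"
    unfolding canonical_height_def using limI[OF naive_height_limit_double[OF a P L(2)]] by simp
  then show ?thesis using L(1) by simp
qed

text \<open>The pair \<open>(4 * s, t)\<close> has odd \<open>t\<close>, so the limit argument
  starts at \<open>4P\<close>: after cancelling 16 its pair \<open>(F, G)\<close> has even
  \<open>G\<close> and \<open>F\<close> coprime to \<open>a * G\<close>.\<close>

lemma canonical_height_double_even_numerator:
  assumes a: "a \<noteq> 0" and P: "on_curve a P" "nontorsion a P"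
    and xQ: "ec_add a P P = Affine (of_int (4 * s) / of_int t) y" and t: "odd t"
    and b: "a = 4 * b" "odd b" and co: "coprime (2 * s) (b * t)"
  shows "1/16 * ln (real_of_int ((4 * s)^2 + \<bar>a\<bar> * t^2)) - 1/8 * ln 2 \<le> canonical_height a P"
proof -
  define Q where "Q = ec_add a P P"
  have Q: "on_curve a Q" "nontorsion a Q"
    unfolding Q_def using ec_add_closed P nontorsion_double a by auto
  define F G where "F = ((2 * s)^2 - b * t^2)^2" and "G = 2 * (2 * s) * t * ((2 * s)^2 + b * t^2)"
  have F: "((4 * s)^2 - a * t^2)^2 = 16 * F" and G: "4 * (4 * s) * t * ((4 * s)^2 + a * t^2) = 16 * G"
    unfolding F_def G_def b by algebra+
  have "y \<noteq> 0" using nontorsion_Affine[OF Q(2)] xQ Q_def by (metis ec_point.inject)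
  moreover have "t \<noteq> 0" using t by auto
  ultimately obtain y' where G0: "16 * G \<noteq> 0"
    and QQ: "ec_add a Q Q = Affine (of_int (16 * F) / of_int (16 * G)) y'"
    using ec_add_self_fraction[of a "4 * s" t y] Q(1) xQ unfolding Q_def F G by metis
  have "odd ((2 * s)^2 - b * t^2)" using b t by simp
  \<comment> \<open>\<open>F\<close> and \<open>2 * G\<close> are the duplication pair of
    \<open>(2 * s, t)\<close> with \<open>b\<close> in place of \<open>a\<close>.\<close>
  then have "coprime F (b * (4 * (2 * s) * t * ((2 * s)^2 + b * t^2)))"
    using coprime_duplication[OF _ co] unfolding F_def by simp
  moreover have "a * G = 2 * (b * (4 * (2 * s) * t * ((2 * s)^2 + b * t^2)))"
    unfolding G_def b by simp
  ultimately have cF: "coprime F (a * G)" by (simp only: coprime_mult_right_iff)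
  have "even G" by (simp add: G_def)
  then obtain L where L: "1/2 * ln (real_of_int (F^2 + \<bar>a\<bar> * G^2)) \<le> L"
    "(\<lambda>n. naive_height (ec_add a Q Q [^]\<^bsub>EC a\<^esub> ((2::nat) ^ n)) / 4 ^ n) \<longlonglongrightarrow> L"
    using naive_height_limit_of_fraction[OF a ec_add_closed[OF Q(1) Q(1)] nontorsion_double[OF a Q], of F G y']
      QQ G0 cF by auto
  then have "(\<lambda>n. naive_height (P [^]\<^bsub>EC a\<^esub> ((2::nat) ^ n)) / 4 ^ n) \<longlonglongrightarrow> L / 4 / 4"
    using naive_height_limit_double[OF a Q] naive_height_limit_double[OF a P] unfolding Q_def by blast
  then have h: "canonical_height a P = L / 32"
    unfolding canonical_height_def by (simp add: limI)
  define N where "N = real_of_int ((4 * s)^2 + \<bar>a\<bar> * t^2)"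
  have N: "N > 0" unfolding N_def using a t by (intro of_int_pos add_nonneg_pos) (auto simp: zero_less_mult_iff)
  have "N^4 \<le> real_of_int ((16 * F)^2 + \<bar>a\<bar> * (16 * G)^2)"
    using norm_duplication_bounds(1)[of "of_int (4 * s)" "of_int a" "of_int t"]
    unfolding N_def F[symmetric] G[symmetric] by simp
  \<comment> \<open>Cancelling 16 divides the norm by \<open>2^8\<close>. With the total factor
    \<open>1/64\<close> at this level, \<open>8 * ln 2\<close> becomes the loss
    \<open>1/8 * ln 2\<close>.\<close>
  then have "N^4 / 2^8 \<le> real_of_int (F^2 + \<bar>a\<bar> * G^2)" by (simp add: power_mult_distrib)
  then have "ln (N^4 / 2^8) \<le> ln (real_of_int (F^2 + \<bar>a\<bar> * G^2))"
    using N by (intro ln_mono) simp_all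
  then have "4 * ln N - 8 * ln 2 \<le> ln (real_of_int (F^2 + \<bar>a\<bar> * G^2))"
    using N by (simp add: ln_div ln_realpow del: power_numeral)
  then show ?thesis using L(1) h unfolding N_def by simp
qed

text \<open>In each residue class the sign of \<open>a\<close> changes the constant by exactly
  \<open>1/16 * ln 2\<close>. The classes cover all cases, since 4 modulo 16 splits into 4, 20, 36
  and 52 modulo 64.\<close>

lemma C_eq:
  assumes "a \<noteq> 0" "\<not> 16 dvd a"
  shows "C a = (if a < 0 then 1/16 * ln 2 else 0) +
    (if a mod 16 \<in> {1, 5, 7, 9, 13, 15} then 1/2 * ln 2
     else if a mod 64 \<in> {4, 52} then - (1/8) * ln 2 else 1/4 * ln 2)"
proof -
  define A B where "A = {1, 5, 7, 9, 13, 15 :: int}" and "B = {2, 3, 6, 8, 10, 11, 12, 14 :: int}"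
  define D E where "D = {4, 52 :: int}" and "E = {20, 36 :: int}"
  have "a mod (16 * 4) = 16 * (a div 16 mod 4) + a mod 16" by (rule zmod_zmult2_eq) simp
  then obtain k r where kr: "a mod 64 = 16 * k + r" "a mod 16 = r"
    and range: "0 \<le> k" "k < 4" "0 \<le> r" "r < 16"
    using that[of "a div 16 mod 4" "a mod 16"] by simp
  have "r \<noteq> 0" using assms(2) kr by auto
  then have "r \<in> set [1..15]" using range by simp
  then have "r \<in> A \<or> r \<in> B \<or> r = 4"
    unfolding A_def B_def by (simp add: upto.simps del: set_upto) blast
  then have AB: "a mod 16 \<in> A \<or> a mod 16 \<in> B \<or> a mod 16 = 4" by (simp add: kr)
  have "k \<in> set [0..3]" using range by simp
  then have "k = 0 \<or> k = 1 \<or> k = 2 \<or> k = 3" by (simp add: upto.simps del: set_upto)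
  then have DE: "a mod 64 \<in> D \<or> a mod 64 \<in> E \<longleftrightarrow> a mod 16 = 4"
    using range unfolding D_def E_def kr by auto
  have disj: "A \<inter> B = {}" "4 \<notin> A" "4 \<notin> B" "D \<inter> E = {}"
    by (auto simp: A_def B_def D_def E_def)
  have "a mod 16 \<in> A \<or> a mod 16 \<in> B \<or> a mod 64 \<in> D \<or> a mod 64 \<in> E"
    "\<not> (a mod 16 \<in> A \<and> a mod 16 \<in> B)" "\<not> (a mod 64 \<in> D \<and> a mod 64 \<in> E)"
    "a mod 64 \<in> D \<Longrightarrow> a mod 16 \<notin> A \<and> a mod 16 \<notin> B"
    using DE AB disj by (blast, blast, blast, metis)
  then show ?thesis
    using assms(1)
    unfolding C_def A_def[symmetric] B_def[symmetric] D_def[symmetric] E_def[symmetric] by auto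
qed

theorem theorem1p2:
  fixes a :: int and P :: ec_point
  assumes "fourth_power_free a"
    and "P \<in> carrier (EC a)"
    and "nontorsion a P"
  shows "canonical_height a P > 1/16 * ln (real_of_int \<bar>a\<bar>) + C a"
proof -
  have P: "on_curve a P" using assms(2) by (simp add: EC_def)
  have a0: "a \<noteq> 0" and a16: "\<not> 16 dvd a"
    using assms(1) by (auto simp: fourth_power_free_def dest: spec[of _ 2])
  obtain \<alpha> \<beta> y where x: "ec_add a P P = Affine (of_int (\<alpha>^2) / of_int (\<beta>^2)) y"
    and \<beta>: "\<beta> > 0" and co: "coprime \<alpha> \<beta>"
    and odd_p: "\<And>p. prime p \<Longrightarrow> odd p \<Longrightarrow> p dvd a \<Longrightarrow> \<not> p dvd \<alpha>"
    and odd\<beta>: "odd \<beta> \<Longrightarrow> even \<alpha> \<and> a mod 64 \<in> {4, 52}"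
    and dvd\<beta>: "a mod 16 \<in> {1, 5, 7, 9, 13, 15} \<Longrightarrow> 4 dvd \<beta>"
    and \<alpha>0: "\<alpha> \<noteq> 0" and pos: "0 < \<alpha>^4 + a * \<beta>^4"
    using double_coordinates[OF assms(1) P assms(3)] by metis
  define N where "N = (\<alpha>^2)^2 + \<bar>a\<bar> * (\<beta>^2)^2"
  \<comment> \<open>For \<open>a < 0\<close> the inequality \<open>pos\<close> says that
    \<open>\<alpha>^4\<close> exceeds \<open>\<bar>a\<bar> * \<beta>^4\<close>, so both summands of
    \<open>N\<close> count.\<close>
  define c :: int where "c = (if a < 0 then 2 else 1)"
  \<comment> \<open>Here \<open>k\<close> is the known lower bound 4, 2 or 1 for \<beta>; after the
    factor \<open>1/16\<close> it contributes \<open>1/2 * ln 2\<close>, \<open>1/4 * ln 2\<close>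
    or 0.\<close>
  have N: "ln (real_of_int \<bar>a\<bar>) + ln c + 4 * ln k < ln N"
    if k: "k \<le> \<beta>" "k > 0" for k :: int
  proof -
    have "c * \<bar>a\<bar> * k^4 \<le> c * \<bar>a\<bar> * \<beta>^4"
      using k by (intro mult_left_mono power_mono) (auto simp: c_def)
    also have "\<dots> < N"
      using pos \<alpha>0 unfolding c_def N_def by (simp add: abs_if)
    finally have lt: "c * \<bar>a\<bar> * k^4 < N" .
    have c: "c > 0" by (simp add: c_def)
    then have p: "c * \<bar>a\<bar> * k^4 > 0" using a0 k by (intro mult_pos_pos) auto
    have "ln (real_of_int (c * \<bar>a\<bar> * k^4)) < ln (real_of_int N)"
      using lt p by (subst ln_less_cancel_iff) (simp_all only: of_int_less_iff of_int_0_less_iff)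
    moreover have "ln (real_of_int (c * \<bar>a\<bar> * k^4)) = ln c + ln (real_of_int \<bar>a\<bar>) + 4 * ln k"
      using c a0 k by (simp add: ln_mult ln_realpow)
    ultimately show ?thesis by simp
  qed
  have lnc: "ln c = (if a < 0 then ln 2 else 0)" by (simp add: c_def)
  have ln4: "ln (4::real) = 2 * ln 2" using ln_realpow[of 2 2] by simp
  have \<beta>0: "\<beta>^2 \<noteq> 0" using \<beta> by simp
  show ?thesis
  proof (cases "even \<beta>")
    case True
    \<comment> \<open>A common prime divides \<alpha>, hence not \<beta>, hence \<open>a\<close>; it
      is odd because \<beta> is even, contradicting \<open>odd_p\<close>.\<close>
    have "coprime (\<alpha>^2) (a * \<beta>^2)"
    proof (rule ccontr)
      assume "\<not> ?thesis"
      then obtain p where p: "prime p" "p dvd \<alpha>^2" "p dvd a * \<beta>^2" by (rule not_coprime_primeE)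
      have "p dvd \<alpha>" using p prime_dvd_power by blast
      moreover have \<beta>p: "\<not> p dvd \<beta>"
        using \<open>p dvd \<alpha>\<close> p(1) co coprime_common_divisor not_prime_unit by metis
      ultimately have "p dvd a" using p by (metis prime_dvd_mult_iff prime_dvd_power)
      moreover have "odd p" using True \<beta>p dvd_trans by (metis dvd_refl p(1) primes_dvd_imp_eq two_is_prime)
      ultimately show False using odd_p p(1) \<open>p dvd \<alpha>\<close> by blast
    qed
    then have h: "1/16 * ln (real_of_int N) \<le> canonical_height a P"
      using canonical_height_double_le[OF a0 P assms(3) x \<beta>0] True unfolding N_def by simp
    have "2 \<le> \<beta>" using True \<beta> by presburger
    show ?thesis
    proof (cases "a mod 16 \<in> {1, 5, 7, 9, 13, 15}")
      case True
      then have "4 \<le> \<beta>" using dvd\<beta> \<beta> zdvd_imp_le by blast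
      then show ?thesis using N[of 4] h True lnc ln4 C_eq[OF a0 a16] by (simp split: if_splits)
    next
      case False
      \<comment> \<open>Even \<beta> is compatible with \<open>a\<close> being 4 or 52 modulo 64,
        where the constant is smaller; hence an inequality.\<close>
      then have "C a \<le> (if a < 0 then 1/16 * ln 2 else 0) + 1/4 * ln 2"
        using False by (auto simp: C_eq[OF a0 a16] intro: order_trans[of _ 0])
      moreover have "ln (real_of_int \<bar>a\<bar>) + ln c + 4 * ln 2 < ln N"
        using N[of 2] \<open>2 \<le> \<beta>\<close> by simp
      ultimately show ?thesis using h lnc by (simp split: if_splits)
    qed
  next
    case False
    obtain s where s: "\<alpha> = 2 * s" using odd\<beta>[OF False] by (auto elim: evenE)
    have "a mod 64 mod 8 = 4" using odd\<beta>[OF False] by auto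
    then have "a mod 8 = 4" by (simp add: mod_mod_cancel)
    then have "a = 4 * (a div 4)" "odd (a div 4)" by presburger+
    then obtain b where b: "a = 4 * b" "odd b" by (rule that)
    have "coprime (2 * s^2) (b * \<beta>^2)"
    proof (rule ccontr)
      assume "\<not> ?thesis"
      then obtain p where p: "prime p" "p dvd 2 * s^2" "p dvd b * \<beta>^2" by (rule not_coprime_primeE)
      have "odd (b * \<beta>^2)" using b False by simp
      then have "odd p" using p(3) dvd_trans by blast
      have "p dvd 2 * (2 * s^2)" using p(2) by (rule dvd_mult)
      then have "p dvd \<alpha>^2" unfolding s by (simp add: power_mult_distrib)
      then have "p dvd \<alpha>" using p prime_dvd_power by blast
      moreover have \<beta>p: "\<not> p dvd \<beta>"
        using \<open>p dvd \<alpha>\<close> p(1) co coprime_common_divisor not_prime_unit by metis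
      ultimately have "p dvd b" using p by (metis prime_dvd_mult_iff prime_dvd_power)
      then show False using odd_p p(1) \<open>odd p\<close> \<open>p dvd \<alpha>\<close> b(1) by simp
    qed
    moreover have \<alpha>s: "\<alpha>^2 = 4 * s^2" unfolding s by (simp add: power_mult_distrib)
    ultimately have h: "1/16 * ln (real_of_int N) - 1/8 * ln 2 \<le> canonical_height a P"
      using canonical_height_double_even_numerator[OF a0 P assms(3) x[unfolded \<alpha>s] _ b] False
      unfolding N_def by simp
    have "a mod 64 mod 16 = 4" using odd\<beta>[OF False] by auto
    then have "a mod 16 = 4" by (simp add: mod_mod_cancel)
    then have "C a = (if a < 0 then 1/16 * ln 2 else 0) - 1/8 * ln 2"
      using odd\<beta>[OF False] C_eq[OF a0 a16] by simp
    then show ?thesis using N[of 1] \<beta> h lnc by (simp split: if_splits)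
  qed
qed

end
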